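(* Let $(X,S)$ be the $\mathcal S$-adic subshift generated by a positive directive sequence $\boldsymbol\tau=(\tau_n:\mathcal A_{n+1}^*\to\mathcal A_n^* )_{n\ge0}$. Then for all large enough $n\in\mathbb N$, $$p_X(n)\le\Big(\max_{i\in\mathbb N}|\mathcal A_i|+2\Big)\Big(\limsup_{i\to+\infty}\operatorname{r-comp}(\tau_i)+1\Big)\cdot n$$ (the right-hand side being understood as $+\infty$ if $(|\mathcal A_i|)_i$ or $(\operatorname{r-comp}(\tau_i))_i$ is unbounded).
   Context: A directive sequence is a sequence $\boldsymbol\tau=(\tau_n:\mathcal A_{n+1}^*\to\mathcal A_n^* )_{n\ge0}$ of non-erasing morphisms of free monoids over finite alphabets. It is positive if for every $n\ge1$ and every $a\in\mathcal A_{n+1}$ the word $\tau_n(a)$ contains all letters of $\mathcal A_n$ (no such condition on $\tau_0$). The $\mathcal S$-adic subshift $X_{\boldsymbol\tau}$ generated by $\boldsymbol\tau$ is the set of $x\in\mathcal A_0^{\mathbb Z}$ all of whose finite factors occur in $\tau_0\circ\cdots\circ\tau_{N-1}(a)$ for some $N\ge1$ and $a\in\mathcal A_N$. $S$ is the shift map and $p_X(n)$ is the number of words of length $n$ occurring in elements of $X$. Repetition complexity: for a morphism $\tau:\mathcal A^*\to\mathcal B^*$ and $a\in\mathcal A$, write $\tau(a)=c_1^{l_1}c_2^{l_2}\cdots c_{k(a)}^{l_{k(a)}}$ with $c_j\in\mathcal B$, $l_j\ge1$ and $c_{j+1}\ne c_j$; so $k(a)$ is the number of maximal blocks of equal letters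 in $\tau(a)$. Then $\operatorname{r-comp}(\tau)=\sum_{a\in\mathcal A}k(a)$. *)

theory Defs
  imports Main "HOL-Library.Sublist" "HOL-Library.Extended_Nat" "HOL-Library.Liminf_Limsup"
begin

text \<open>The free monoid over an alphabet \<open>A\<close> is \<open>lists A\<close> with concatenation.  A map on all lists
  represents a morphism through its restriction to \<open>lists A\<close>; its values elsewhere are irrelevant.
  Preservation of the empty word follows from the second condition by cancellation.\<close>

definition word_morphism :: "'a set \<Rightarrow> 'b set \<Rightarrow> ('a list \<Rightarrow> 'b list) \<Rightarrow> bool" where
  "word_morphism A B f \<longleftrightarrow>
     (\<forall>u \<in> lists A. f u \<in> lists B) \<and>
     (\<forall>u \<in> lists A. \<forall>v \<in> lists A. f (u @ v) = f u @ f v)"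

definition non_erasing :: "'a set \<Rightarrow> ('a list \<Rightarrow> 'b list) \<Rightarrow> bool" where
  "non_erasing A f \<longleftrightarrow> (\<forall>a \<in> A. f [a] \<noteq> [])"

definition directive_sequence :: "(nat \<Rightarrow> 'a set) \<Rightarrow> (nat \<Rightarrow> 'a list \<Rightarrow> 'a list) \<Rightarrow> bool" where
  "directive_sequence A \<tau> \<longleftrightarrow>
     (\<forall>n. finite (A n)) \<and>
     (\<forall>n. word_morphism (A (Suc n)) (A n) (\<tau> n)) \<and>
     (\<forall>n. non_erasing (A (Suc n)) (\<tau> n))"

definition positive_sequence :: "(nat \<Rightarrow> 'a set) \<Rightarrow> (nat \<Rightarrow> 'a list \<Rightarrow> 'a list) \<Rightarrow> bool" where
  "positive_sequence A \<tau> \<longleftrightarrow> (\<forall>n \<ge> 1. \<forall>a \<in> A (Suc n). A n \<subseteq> set (\<tau> n [a]))"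

text \<open>\<open>morphism_comp \<tau> N\<close> is \<open>\<tau> 0 \<circ> \<dots> \<circ> \<tau> (N - 1)\<close>, from words over \<open>A N\<close> to words over \<open>A 0\<close>.\<close>

primrec morphism_comp :: "(nat \<Rightarrow> 'a list \<Rightarrow> 'a list) \<Rightarrow> nat \<Rightarrow> 'a list \<Rightarrow> 'a list" where
  "morphism_comp \<tau> 0 = id"
| "morphism_comp \<tau> (Suc N) = morphism_comp \<tau> N \<circ> \<tau> N"

definition word_at :: "(int \<Rightarrow> 'a) \<Rightarrow> int \<Rightarrow> nat \<Rightarrow> 'a list" where
  "word_at x i n = map (\<lambda>k. x (i + int k)) [0..<n]"

definition S_adic_subshift :: "(nat \<Rightarrow> 'a set) \<Rightarrow> (nat \<Rightarrow> 'a list \<Rightarrow> 'a list) \<Rightarrow> (int \<Rightarrow> 'a) set" where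
  "S_adic_subshift A \<tau> =
     {x. range x \<subseteq> A 0 \<and>
         (\<forall>i n. \<exists>N \<ge> 1. \<exists>a \<in> A N. sublist (word_at x i n) (morphism_comp \<tau> N [a]))}"

definition factor_complexity :: "(int \<Rightarrow> 'a) set \<Rightarrow> nat \<Rightarrow> nat" where
  "factor_complexity X n = card {w. \<exists>x \<in> X. \<exists>i. w = word_at x i n}"

text \<open>The number of maximal blocks of equal letters: \<open>remdups_adj\<close> keeps one letter of each block.
  The lemma below is the description by \<open>w = c\<^sub>1\<^bsup>l\<^sub>1\<^esup> \<dots> c\<^sub>k\<^bsup>l\<^sub>k\<^esup>\<close>.\<close>

definition num_blocks :: "'a list \<Rightarrow> nat" where
  "num_blocks w = length (remdups_adj w)"

lemma num_blocks_iff: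
  "num_blocks w = k \<longleftrightarrow>
     (\<exists>bs. w = concat (map (\<lambda>(c, l). replicate l c) bs) \<and> (\<forall>(c, l) \<in> set bs. l \<ge> 1) \<and>
           (\<forall>j. Suc j < length bs \<longrightarrow> fst (bs ! Suc j) \<noteq> fst (bs ! j)) \<and> length bs = k)"
proof -
  define D where "D w bs \<longleftrightarrow> w = concat (map (\<lambda>(c, l). replicate l c) bs) \<and>
      (\<forall>(c, l) \<in> set bs. l \<ge> 1) \<and> distinct_adj (map fst bs)"
    for w :: "'a list" and bs :: "('a \<times> nat) list"
  have len: "remdups_adj w = map fst bs" if "D w bs" for w bs
    using that
  proof (induction bs arbitrary: w)
    case Nil
    then show ?case by (simp add: D_def)
  next
    case (Cons b bs)
    obtain c l where b: "b = (c, l)" by (cases b)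
    define v where "v = concat (map (\<lambda>(c, l). replicate l c) bs)"
    have w: "w = replicate l c @ v" and l: "l \<ge> 1"
      using Cons.prems by (auto simp: D_def v_def b)
    have "D v bs"
      using Cons.prems by (auto simp: D_def v_def distinct_adj_Cons)
    then have v: "remdups_adj v = map fst bs" by (rule Cons.IH)
    have hd: "bs = [] \<or> c \<noteq> fst (hd bs)"
      using Cons.prems by (cases bs) (auto simp: D_def b distinct_adj_Cons)
    have "remdups_adj (replicate m c @ v) = c # map fst bs" if "m \<ge> 1" for m
      using that
    proof (induction m rule: dec_induct)
      case base
      have "v = [] \<longleftrightarrow> bs = []" using v by (metis map_is_Nil_conv remdups_adj_Nil_iff)
      moreover have "hd v = fst (hd bs)" if "bs \<noteq> []"
        using v that by (metis hd_map hd_remdups_adj)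
      ultimately show ?case using hd v by (cases v) (auto simp: remdups_adj_Cons split: list.splits)
    next
      case (step m)
      then show ?case by (cases m) (auto simp: remdups_adj_Cons)
    qed
    then show ?case using l by (simp add: w b)
  qed
  have ex: "\<exists>bs. D w bs" for w
  proof (induction w)
    case Nil
    have "D [] []" by (simp add: D_def)
    then show ?case ..
  next
    case (Cons a w)
    then obtain bs where bs: "D w bs" ..
    show ?case
    proof (cases bs)
      case Nil
      with bs have "D (a # w) [(a, 1)]" by (auto simp: D_def)
      then show ?thesis ..
    next
      case (Cons b bs')
      obtain c l where b: "b = (c, l)" by (cases b)
      show ?thesis
      proof (cases "a = c")
        case True
        with bs Cons b have "D (a # w) ((a, Suc l) # bs')"
          by (cases bs') (auto simp: D_def distinct_adj_Cons)
        then show ?thesis ..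
      next
        case False
        with bs Cons b have "D (a # w) ((a, 1) # bs)"
          by (auto simp: D_def distinct_adj_Cons)
        then show ?thesis ..
      qed
    qed
  qed
  have adj: "distinct_adj (map fst bs) \<longleftrightarrow>
      (\<forall>j. Suc j < length bs \<longrightarrow> fst (bs ! Suc j) \<noteq> fst (bs ! j))" for bs :: "('a \<times> nat) list"
    by (auto simp: distinct_adj_conv_nth less_diff_conv Suc_lessD) 
  have "num_blocks w = k \<longleftrightarrow> (\<exists>bs. D w bs \<and> length bs = k)"
    using ex[of w] len[of w] unfolding num_blocks_def by (metis length_map)
  then show ?thesis unfolding D_def adj by simp
qed

definition r_comp :: "'a set \<Rightarrow> ('a list \<Rightarrow> 'b list) \<Rightarrow> nat" where
  "r_comp A f = (\<Sum>a \<in> A. num_blocks (f [a]))"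

end

theory Submission
  imports Defs
begin

text \<open>Write \<open>\<sigma>\<^sub>N = \<tau>\<^sub>0 \<circ> \<dots> \<circ> \<tau>\<^bsub>N-1\<^esub>\<close> and \<open>H\<^sub>N = \<Sum>\<^bsub>a \<in> A\<^sub>N\<^esub> |\<sigma>\<^sub>N(a)|\<close>.  Given \<open>n\<close>, let \<open>M\<close> be
  minimal with \<open>n < H\<^sub>M\<close>, so that \<open>H\<^bsub>M-1\<^esub> \<le> n\<close> and, by positivity, \<open>n < |\<sigma>\<^bsub>M+1\<^esub>(a)|\<close> for all \<open>a\<close>.
  With \<open>K\<close> bounding the alphabets and \<open>R\<close> the repetition complexities, a word of length \<open>n\<close> either
  \<^item> straddles the junction of \<open>\<sigma>\<^bsub>M+1\<^esub>(a) \<sigma>\<^bsub>M+1\<^esub>(b)\<close>: at most \<open>|A\<^bsub>M+1\<^esub>|\<^sup>2 n \<le> K R n\<close> words, since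
    \<open>|A\<^bsub>M+1\<^esub>| \<le> R\<close>;
  \<^item> straddles a block boundary of \<open>\<tau>\<^sub>M(a)\<close> inside \<open>\<sigma>\<^bsub>M+1\<^esub>(a)\<close>: at most \<open>R n\<close> words;
  \<^item> lies in a power of some \<open>\<sigma>\<^sub>M(c)\<close>.  If \<open>|\<sigma>\<^sub>M(c)| \<le> n\<close> or the word straddles the junction of
    \<open>\<sigma>\<^sub>M(c) \<sigma>\<^sub>M(c)\<close>, this gives at most \<open>n\<close> words for each \<open>c\<close>, so \<open>K n\<close> in total; otherwise the word
    lies inside \<open>\<sigma>\<^sub>M(c)\<close> and either straddles a block boundary of \<open>\<tau>\<^bsub>M-1\<^esub>(c)\<close> (at most \<open>R n\<close> words) or lies
    in a power of some \<open>\<sigma>\<^bsub>M-1\<^esub>(d)\<close> (at most \<open>H\<^bsub>M-1\<^esub> \<le> n\<close> words).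

  The sum \<open>(K R + 2 R + K + 1) n\<close> is smaller than \<open>(K + 2) (R + 1) n\<close>.\<close>

section \<open>Words straddling a junction\<close>

definition cuts :: "nat \<Rightarrow> 'a list \<Rightarrow> 'a list \<Rightarrow> 'a list set" where
  "cuts n u v = {x @ y |x y. suffix x u \<and> prefix y v \<and> x \<noteq> [] \<and> length x + length y = n}"

text \<open>The length of the non-empty left part determines the word and has \<open>n\<close>
  possible values; the right part may be empty.\<close>

lemma cuts_subset: "cuts n u v \<subseteq> (\<lambda>k. drop (length u - k) u @ take (n - k) v) ` {1..n}"
proof
  fix w assume "w \<in> cuts n u v"
  then obtain x y where w: "w = x @ y" "suffix x u" "prefix y v" "x \<noteq> []" "length x + length y = n"
    by (auto simp: cuts_def)
  have "x = drop (length u - length x) u" "y = take (n - length x) v"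
    using w by (auto simp: suffix_def prefix_def)
  moreover have "length x \<in> {1..n}"
    using w(4,5) by (cases x) auto
  ultimately show "w \<in> (\<lambda>k. drop (length u - k) u @ take (n - k) v) ` {1..n}"
    using w(1) by blast
qed

lemma finite_cuts: "finite (cuts n u v)"
  using cuts_subset by (rule finite_subset) simp

lemma card_cuts_le: "card (cuts n u v) \<le> n"
  using surj_card_le[OF _ cuts_subset, of n u v] by simp

text \<open>A word spanning several entries is charged to the first boundary that it crosses; hence
  the whole concatenations on both sides.\<close>

lemma sublist_concat_cases:
  assumes "sublist w (concat ts)" and "w \<noteq> []"
  shows "(\<exists>t \<in> set ts. sublist w t) \<or>
    (\<exists>j < length ts. w \<in> cuts (length w) (concat (take j ts)) (concat (drop j ts)))"
  using assms(1)
proof (induction ts)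
  case Nil
  then show ?case using assms(2) by simp
next
  case (Cons t ts)
  have tail: ?case if "sublist w (concat ts)"
    using Cons.IH[OF that]
  proof
    assume "\<exists>j<length ts. w \<in> cuts (length w) (concat (take j ts)) (concat (drop j ts))"
    then obtain j where j: "j < length ts"
      "w \<in> cuts (length w) (concat (take j ts)) (concat (drop j ts))" by blast
    then have "w \<in> cuts (length w) (concat (take (Suc j) (t # ts))) (concat (drop (Suc j) (t # ts)))"
      unfolding cuts_def by (auto intro: suffix_appendI)
    then show ?thesis using j(1) by (metis Suc_less_eq length_Cons)
  qed auto
  from Cons.prems consider "sublist w t" | "sublist w (concat ts)"
    | x y where "w = x @ y" "suffix x t" "prefix y (concat ts)"
    by (auto simp: sublist_append)
  then show ?case
  proof cases
    case 3
    \<comment> \<open>If \<open>x = []\<close>, the word lies in the tail; if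
      \<open>ts = []\<close>, it lies in \<open>t\<close>. Only the third case is a genuine cut
      after \<open>t\<close>.\<close>
    consider "x = []" | "ts = []" | "x \<noteq> []" "ts \<noteq> []" by blast
    then show ?thesis
    proof cases
      case 1
      with 3 show ?thesis by (intro tail) auto
    next
      case 2
      with 3 show ?thesis by auto
    next
      case c: 3
      have "w \<in> cuts (length w) (concat (take 1 (t # ts))) (concat (drop 1 (t # ts)))"
        using 3 c(1) by (auto simp: cuts_def)
      moreover have "1 < length (t # ts)" using c(2) by simp
      ultimately show ?thesis by blast
    qed
  qed (use tail in auto)
qed

text \<open>Each part of a straddling word fits into the entry next to the boundary. That
  \<open>t\<close> and \<open>t'\<close> are neighbours is forgotten, so the count can run over all
  pairs of letters.\<close>

lemma sublist_concat_long:
  assumes "sublist w (concat ts)" and "w \<noteq> []" and long: "\<forall>t \<in> set ts. length w \<le> length t"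
  shows "(\<exists>t \<in> set ts. sublist w t) \<or> (\<exists>t \<in> set ts. \<exists>t' \<in> set ts. w \<in> cuts (length w) t t')"
  using sublist_concat_cases[OF assms(1,2)]
proof
  assume "\<exists>j<length ts. w \<in> cuts (length w) (concat (take j ts)) (concat (drop j ts))"
  then obtain j x y where j: "j < length ts" and w: "w = x @ y" "x \<noteq> []"
    and x: "suffix x (concat (take j ts))" and y: "prefix y (concat (drop j ts))"
    by (auto simp: cuts_def)
  have "j \<noteq> 0" using x w(2) by (intro notI) simp
  then obtain i where i: "j = Suc i" by (cases j) auto
  have mem: "ts ! i \<in> set ts" "ts ! j \<in> set ts" using j i by auto
  have "suffix x (concat (take i ts) @ ts ! i)"
    using x j by (simp add: i take_Suc_conv_app_nth)
  moreover have "length x \<le> length (ts ! i)" using long mem(1) w(1) by fastforce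
  ultimately have sx: "suffix x (ts ! i)"
    by (meson suffix_length_suffix suffixI)
  have "prefix y (ts ! j @ concat (drop (Suc j) ts))"
    using y j by (simp flip: Cons_nth_drop_Suc)
  moreover have "length y \<le> length (ts ! j)" using long mem(2) w(1) by fastforce
  ultimately have "prefix y (ts ! j)"
    by (meson prefix_length_prefix prefixI)
  with sx w have "w \<in> cuts (length w) (ts ! i) (ts ! j)"
    by (auto simp: cuts_def)
  with mem show ?thesis by blast
qed simp

section \<open>Words in powers, and block boundaries\<close>

definition periodic_words :: "nat \<Rightarrow> 'a list \<Rightarrow> 'a list set" where
  "periodic_words n t = {w. length w = n \<and> (\<exists>l. sublist w (concat (replicate l t)))}"

lemma nth_concat_replicate:
  "i < l * length t \<Longrightarrow> concat (replicate l t) ! i = t ! (i mod length t)"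
proof (induction l arbitrary: i)
  case (Suc l)
  show ?case
  proof (cases "i < length t")
    case False
    then have "i - length t < l * length t" using Suc.prems by simp
    from Suc.IH[OF this] False show ?thesis by (simp add: nth_append le_mod_geq)
  qed (simp add: nth_append)
qed simp

text \<open>A factor of a power of \<open>t\<close> is determined by its starting position modulo
  \<open>length t\<close>.\<close>

lemma periodic_words_subset:
  assumes "n > 0"
  shows "periodic_words n t \<subseteq> (\<lambda>k. map (\<lambda>i. t ! ((k + i) mod length t)) [0..<n]) ` {..<length t}"
proof
  fix w assume "w \<in> periodic_words n t"
  then obtain l x y where n: "length w = n" and eq: "concat (replicate l t) = x @ w @ y"
    by (auto simp: periodic_words_def sublist_def)
  from eq have "length (concat (replicate l t)) = length (x @ w @ y)" by simp
  then have len: "l * length t = length x + n + length y"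
    by (simp add: n length_concat sum_list_replicate)
  then have t: "length t > 0" using assms by (cases "length t") auto
  have "w ! i = t ! ((length x mod length t + i) mod length t)" if "i < n" for i
  proof -
    have "w ! i = concat (replicate l t) ! (length x + i)"
      using that n by (simp add: eq nth_append)
    also have "\<dots> = t ! ((length x + i) mod length t)"
      using that len by (intro nth_concat_replicate) simp
    finally show ?thesis by (simp add: mod_add_left_eq)
  qed
  then have "w = map (\<lambda>i. t ! ((length x mod length t + i) mod length t)) [0..<n]"
    using n by (intro nth_equalityI) auto
  then show "w \<in> (\<lambda>k. map (\<lambda>i. t ! ((k + i) mod length t)) [0..<n]) ` {..<length t}"
    using t by auto
qed

lemma finite_periodic_words: "n > 0 \<Longrightarrow> finite (periodic_words n t)"
  by (rule finite_subset[OF periodic_words_subset]) simp_all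

lemma card_periodic_words_le: "n > 0 \<Longrightarrow> card (periodic_words n t) \<le> length t"
  using surj_card_le[OF finite_lessThan periodic_words_subset] by (metis card_lessThan)

text \<open>A block of equal letters maps to a power of \<open>s c\<close>, so only block boundaries
  contribute to \<open>B\<close>. The periodic words stay outside because they depend on
  \<open>c\<close> alone: they can be counted once per letter instead of once per block.\<close>

lemma block_decomposition:
  fixes s :: "'b \<Rightarrow> 'a list"
  assumes "n > 0"
  obtains B where "finite B" "card B \<le> num_blocks v * n"
    and "\<And>w. sublist w (concat (map s v)) \<Longrightarrow> length w = n \<Longrightarrow>
          w \<in> B \<union> (\<Union>c \<in> set v. periodic_words n (s c))"
proof -
  obtain bs where v: "v = concat (map (\<lambda>(c, l). replicate l c) bs)"
    and pos: "\<forall>(c, l) \<in> set bs. l \<ge> 1" and len: "length bs = num_blocks v"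
    using num_blocks_iff[of v "num_blocks v"] by auto
  define ts where "ts = map (\<lambda>(c, l). concat (replicate l (s c))) bs"
  have cts: "concat (map s v) = concat ts"
    unfolding v ts_def by (induction bs) (auto simp: map_replicate)
  define B where "B = (\<Union>j < length ts. cuts n (concat (take j ts)) (concat (drop j ts)))"
  have "finite B" by (simp add: B_def finite_cuts)
  moreover have "card B \<le> num_blocks v * n"
  proof -
    have "card B \<le> (\<Sum>j < length ts. card (cuts n (concat (take j ts)) (concat (drop j ts))))"
      unfolding B_def by (rule card_UN_le) simp
    also have "\<dots> \<le> (\<Sum>j < length ts. n)" by (intro sum_mono card_cuts_le)
    finally show ?thesis by (simp add: ts_def len)
  qed
  moreover have "w \<in> B \<union> (\<Union>c \<in> set v. periodic_words n (s c))"
    if w: "sublist w (concat (map s v))" "length w = n" for w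
  proof -
    have "w \<noteq> []" using w(2) assms by auto
    from sublist_concat_cases[OF w(1)[unfolded cts] this] show ?thesis
    proof
      assume "\<exists>t \<in> set ts. sublist w t"
      then obtain c l where cl: "(c, l) \<in> set bs" "sublist w (concat (replicate l (s c)))"
        by (auto simp: ts_def)
      \<comment> \<open>An empty block would not put \<open>c\<close> into \<open>v\<close>; this is
        where \<open>l \<ge> 1\<close> matters.\<close>
      have "c \<in> set (replicate l c)" using pos cl(1) by auto
      then have "c \<in> set v" using cl(1) unfolding v set_concat set_map by blast
      then show ?thesis using cl(2) w(2) by (auto simp: periodic_words_def)
    qed (auto simp: B_def w(2))
  qed
  ultimately show ?thesis by (rule that)
qed

lemma block_decomposition_UN:
  fixes s :: "'b \<Rightarrow> 'a list"
  assumes "n > 0" and "finite I"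
  obtains B where "finite B" "card B \<le> (\<Sum>a \<in> I. num_blocks (f a)) * n"
    and "\<And>w a. a \<in> I \<Longrightarrow> sublist w (concat (map s (f a))) \<Longrightarrow> length w = n \<Longrightarrow>
          w \<in> B \<union> (\<Union>c \<in> set (f a). periodic_words n (s c))"
proof -
  have "\<exists>B. finite B \<and> card B \<le> num_blocks (f a) * n \<and>
     (\<forall>w. sublist w (concat (map s (f a))) \<longrightarrow> length w = n \<longrightarrow>
          w \<in> B \<union> (\<Union>c \<in> set (f a). periodic_words n (s c)))" for a
    using block_decomposition[OF assms(1), of "f a" s] by metis
  then obtain B where B: "\<And>a. finite (B a)" "\<And>a. card (B a) \<le> num_blocks (f a) * n"
    "\<And>a w. sublist w (concat (map s (f a))) \<Longrightarrow> length w = n \<Longrightarrow>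
          w \<in> B a \<union> (\<Union>c \<in> set (f a). periodic_words n (s c))"
    by metis
  have "card (\<Union>a \<in> I. B a) \<le> (\<Sum>a \<in> I. card (B a))" by (rule card_UN_le[OF assms(2)])
  also have "\<dots> \<le> (\<Sum>a \<in> I. num_blocks (f a) * n)" by (intro sum_mono B)
  finally have "card (\<Union>a \<in> I. B a) \<le> (\<Sum>a \<in> I. num_blocks (f a)) * n"
    by (simp add: sum_distrib_right)
  then show ?thesis
    by (intro that[of "\<Union>a \<in> I. B a"]) (use B assms(2) in blast)+
qed

section \<open>Morphisms, lengths and desubstitution\<close>

lemma word_morphism_Nil:
  assumes "word_morphism A B f" shows "f [] = []"
proof -
  have "f ([] @ []) = f [] @ f []" using assms unfolding word_morphism_def by blast
  then show ?thesis by simp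
qed

lemma word_morphism_conv_concat:
  assumes f: "word_morphism A B f" and "u \<in> lists A"
  shows "f u = concat (map (\<lambda>a. f [a]) u)"
  using assms(2)
proof induction
  case Nil
  then show ?case using word_morphism_Nil[OF f] by simp
next
  case (Cons a u)
  then have "[a] \<in> lists A" "u \<in> lists A" by simp_all
  then have "f ([a] @ u) = f [a] @ f u"
    using f unfolding word_morphism_def by blast
  with Cons show ?case by simp
qed

lemma word_morphism_comp:
  assumes "\<And>n. word_morphism (A (Suc n)) (A n) (\<tau> n)"
  shows "word_morphism (A N) (A 0) (morphism_comp \<tau> N)"
proof (induction N)
  case 0
  then show ?case by (simp add: word_morphism_def)
next
  case (Suc N)
  then show ?case using assms[of N] by (simp add: word_morphism_def)
qed

lemma morphism_comp_desubstitute: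
  assumes "\<And>n. word_morphism (A (Suc n)) (A n) (\<tau> n)" and "M \<le> N" and "v \<in> lists (A N)"
  shows "\<exists>u \<in> lists (A M). morphism_comp \<tau> N v = morphism_comp \<tau> M u"
  using assms(2,3)
proof (induction N arbitrary: v rule: dec_induct)
  case base
  then show ?case by blast
next
  case (step N)
  have "\<tau> N v \<in> lists (A N)"
    using assms(1)[of N] step.prems by (auto simp: word_morphism_def)
  from step.IH[OF this] show ?case by simp
qed

definition total_length :: "(nat \<Rightarrow> 'a set) \<Rightarrow> (nat \<Rightarrow> 'a list \<Rightarrow> 'a list) \<Rightarrow> nat \<Rightarrow> nat" where
  "total_length A \<tau> N = (\<Sum>a \<in> A N. length (morphism_comp \<tau> N [a]))"

lemma length_le_total_length:
  "finite (A N) \<Longrightarrow> a \<in> A N \<Longrightarrow> length (morphism_comp \<tau> N [a]) \<le> total_length A \<tau> N"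
  unfolding total_length_def by (rule member_le_sum) auto

lemma sum_set_le_sum_list:
  fixes f :: "'a \<Rightarrow> nat"
  shows "(\<Sum>x \<in> set xs. f x) \<le> (\<Sum>x \<leftarrow> xs. f x)"
  by (induction xs) (auto simp: sum.insert_if)

text \<open>By positivity every letter of \<open>A N\<close> occurs in \<open>\<tau> N [a]\<close>,
  so the length of its image is counted at least once.\<close>

lemma total_length_le:
  assumes "directive_sequence A \<tau>" "positive_sequence A \<tau>" and "N \<ge> 1" and "a \<in> A (Suc N)"
  shows "total_length A \<tau> N \<le> length (morphism_comp \<tau> (Suc N) [a])"
proof -
  have mor: "word_morphism (A (Suc n)) (A n) (\<tau> n)" for n
    using assms(1) by (simp add: directive_sequence_def)
  have v: "\<tau> N [a] \<in> lists (A N)"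
    using mor[of N] assms(4) by (simp add: word_morphism_def)
  moreover have "A N \<subseteq> set (\<tau> N [a])"
    using assms by (simp add: positive_sequence_def)
  ultimately have "A N = set (\<tau> N [a])" by auto
  then have "total_length A \<tau> N \<le> (\<Sum>c \<leftarrow> \<tau> N [a]. length (morphism_comp \<tau> N [c]))"
    unfolding total_length_def using sum_set_le_sum_list by metis
  also have "\<dots> = length (morphism_comp \<tau> (Suc N) [a])"
    using word_morphism_conv_concat[OF word_morphism_comp[of A, OF mor] v]
    by (simp add: length_concat o_def)
  finally show ?thesis .
qed

lemma S_adic_word_desubstitute:
  assumes "directive_sequence A \<tau>" and "x \<in> S_adic_subshift A \<tau>"
  shows "\<exists>u \<in> lists (A M). sublist (word_at x i n) (morphism_comp \<tau> M u)"
proof -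
  \<comment> \<open>A window longer than all words of the levels below \<open>M\<close> can only occur at a level \<open>\<ge> M\<close>.\<close>
  define m where "m = n + (\<Sum>N < M. total_length A \<tau> N) + 1"
  obtain N a where a: "a \<in> A N" "sublist (word_at x i m) (morphism_comp \<tau> N [a])"
    using assms(2) unfolding S_adic_subshift_def by blast
  have "M \<le> N"
  proof (rule ccontr)
    assume "\<not> M \<le> N"
    then have "total_length A \<tau> N \<le> (\<Sum>N < M. total_length A \<tau> N)"
      by (intro member_le_sum) auto
    moreover have "m \<le> length (morphism_comp \<tau> N [a])"
      using sublist_length_le[OF a(2)] by (simp add: word_at_def)
    moreover have "\<dots> \<le> total_length A \<tau> N"
      using assms(1) a(1) by (intro length_le_total_length) (auto simp: directive_sequence_def)
    ultimately show False by (simp add: m_def)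
  qed
  then obtain u where u: "u \<in> lists (A M)" "morphism_comp \<tau> N [a] = morphism_comp \<tau> M u"
    using morphism_comp_desubstitute[of A \<tau> M N "[a]"] assms(1) a(1)
    by (auto simp: directive_sequence_def)
  have "word_at x i n = take n (word_at x i m)"
    by (simp add: word_at_def m_def take_map)
  then have "sublist (word_at x i n) (word_at x i m)"
    by (metis prefix_imp_sublist take_is_prefix)
  then show ?thesis using a(2) u by (metis sublist_order.order.trans)
qed

section \<open>The count for a fixed length\<close>

lemma factor_complexity_le:
  assumes dir: "directive_sequence A \<tau>" and pos: "positive_sequence A \<tau>"
    and K: "\<And>i. card (A i) \<le> K"
    and R: "\<And>i. i \<ge> L \<Longrightarrow> r_comp (A (Suc i)) (\<tau> i) \<le> R"
    and n: "n > 0" "n \<ge> (\<Sum>N \<le> Suc L. total_length A \<tau> N)"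
  shows "factor_complexity (S_adic_subshift A \<tau>) n \<le> (K + 2) * (R + 1) * n"
proof (cases "\<exists>M. n < total_length A \<tau> M")
  case False
  \<comment> \<open>A window of length \<open>n + 1\<close> would have to fit into a word no longer
    than some \<open>total_length A \<tau> N\<close>, hence of length at most
    \<open>n\<close>.\<close>
  have "S_adic_subshift A \<tau> = {}"
  proof (rule ccontr)
    assume "S_adic_subshift A \<tau> \<noteq> {}"
    then obtain x where "x \<in> S_adic_subshift A \<tau>" by blast
    then obtain N a where a: "a \<in> A N" "sublist (word_at x 0 (Suc n)) (morphism_comp \<tau> N [a])"
      unfolding S_adic_subshift_def by blast
    have "Suc n \<le> length (morphism_comp \<tau> N [a])"
      using sublist_length_le[OF a(2)] by (simp add: word_at_def)
    also have "\<dots> \<le> total_length A \<tau> N"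
      using dir a(1) by (intro length_le_total_length) (auto simp: directive_sequence_def)
    finally show False using False by (metis Suc_le_lessD)
  qed
  then show ?thesis by (simp add: factor_complexity_def)
next
  case True
  define M where "M = (LEAST M. n < total_length A \<tau> M)"
  have M: "n < total_length A \<tau> M" unfolding M_def using True by (rule LeastI_ex)
  \<comment> \<open>Both \<open>M\<close> and its predecessor \<open>P\<close> must lie beyond
    \<open>L\<close>, so that \<open>R\<close> bounds the repetition complexity of
    \<open>\<tau> M\<close> and of \<open>\<tau> P\<close>.\<close>
  have "\<not> M \<le> Suc L"
  proof
    assume "M \<le> Suc L"
    then have "total_length A \<tau> M \<le> (\<Sum>N \<le> Suc L. total_length A \<tau> N)"
      by (intro member_le_sum) auto
    then show False using M n(2) by simp
  qed
  then obtain P where P: "M = Suc P" "L < P" by (cases M) auto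
  have "total_length A \<tau> P \<le> n"
    using not_less_Least[of P "\<lambda>M. n < total_length A \<tau> M"] P(1) M_def by simp
  have fin: "finite (A N)" for N using dir by (simp add: directive_sequence_def)
  have mor: "word_morphism (A (Suc N)) (A N) (\<tau> N)" for N
    using dir by (simp add: directive_sequence_def)
  note conv = word_morphism_conv_concat[OF word_morphism_comp[of A, OF mor]]
  define s where "s = (\<lambda>N a. morphism_comp \<tau> N [a])"
  have img: "\<tau> N [a] \<in> lists (A N)" if "a \<in> A (Suc N)" for N a
    using mor[of N] that by (simp add: word_morphism_def)
  have s_Suc: "s (Suc N) a = concat (map (s N) (\<tau> N [a]))" if "a \<in> A (Suc N)" for N a
    using conv[OF img[OF that]] by (simp add: s_def)

  obtain B1 where B1: "finite B1" "card B1 \<le> r_comp (A (Suc M)) (\<tau> M) * n"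
    and dec1: "\<And>w a. a \<in> A (Suc M) \<Longrightarrow> sublist w (concat (map (s M) (\<tau> M [a]))) \<Longrightarrow> length w = n \<Longrightarrow>
          w \<in> B1 \<union> (\<Union>c \<in> set (\<tau> M [a]). periodic_words n (s M c))"
    by (rule block_decomposition_UN[OF n(1) fin[of "Suc M"], of "\<lambda>a. \<tau> M [a]" "s M",
        folded r_comp_def]) blast
  obtain B2 where B2: "finite B2" "card B2 \<le> r_comp (A M) (\<tau> P) * n"
    and dec2: "\<And>w a. a \<in> A M \<Longrightarrow> sublist w (concat (map (s P) (\<tau> P [a]))) \<Longrightarrow> length w = n \<Longrightarrow>
          w \<in> B2 \<union> (\<Union>c \<in> set (\<tau> P [a]). periodic_words n (s P c))"
    by (rule block_decomposition_UN[OF n(1) fin[of M], of "\<lambda>a. \<tau> P [a]" "s P",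
        folded r_comp_def]) blast
  define C where "C = (\<Union>(a, b) \<in> A (Suc M) \<times> A (Suc M). cuts n (s (Suc M) a) (s (Suc M) b))"
  \<comment> \<open>Either choice has at most \<open>n\<close> words: the periodic ones number at
    most \<open>length (s M c)\<close>, and a single junction gives at most
    \<open>n\<close>.\<close>
  define q where "q c = (if length (s M c) \<le> n then periodic_words n (s M c)
    else cuts n (s M c) (s M c))" for c
  define Q where "Q = (\<Union>c \<in> A M. q c)"
  define E where "E = (\<Union>d \<in> A P. periodic_words n (s P d))"

  have Q_or: "w \<in> Q \<union> B2 \<union> E" if c: "c \<in> A M" and w: "w \<in> periodic_words n (s M c)" for c w
  proof (cases "length (s M c) \<le> n")
    case True
    then show ?thesis using c w by (auto simp: Q_def q_def)
  next
    case False
    obtain l where l: "sublist w (concat (replicate l (s M c)))" and len: "length w = n"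
      using w by (auto simp: periodic_words_def)
    have "w \<noteq> []" using len n(1) by auto
    then have "sublist w (s M c) \<or> w \<in> cuts n (s M c) (s M c)"
      using sublist_concat_long[OF l] False len by auto
    then show ?thesis
    proof
      assume "sublist w (s M c)"
      then have "w \<in> B2 \<union> (\<Union>d \<in> set (\<tau> P [c]). periodic_words n (s P d))"
        using dec2[OF c _ len] s_Suc[of c P] c P(1) by simp
      then show ?thesis using img[of c P] c P(1) by (auto simp: E_def)
    qed (use False c in \<open>auto simp: Q_def q_def\<close>)
  qed

  have "{w. \<exists>x \<in> S_adic_subshift A \<tau>. \<exists>i. w = word_at x i n} \<subseteq> C \<union> B1 \<union> (Q \<union> B2 \<union> E)"
  proof
    fix w assume "w \<in> {w. \<exists>x \<in> S_adic_subshift A \<tau>. \<exists>i. w = word_at x i n}"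
    then obtain x i where x: "x \<in> S_adic_subshift A \<tau>" and w_def: "w = word_at x i n"
      by blast
    have len: "length w = n" by (simp add: w_def word_at_def)
    then have "w \<noteq> []" using n(1) by auto
    obtain u where u: "u \<in> lists (A (Suc M))" "sublist w (morphism_comp \<tau> (Suc M) u)"
      using S_adic_word_desubstitute[OF dir x] unfolding w_def by blast
    have sub: "sublist w (concat (map (s (Suc M)) u))"
      using u(2) unfolding conv[OF u(1)] s_def .
    \<comment> \<open>The choice of \<open>M\<close> gives
      \<open>n < total_length A \<tau> M\<close>, which positivity carries to every image one level
      up.\<close>
    have "\<forall>t \<in> set (map (s (Suc M)) u). length w \<le> length t"
      using total_length_le[OF dir pos, of M] M P u(1) len unfolding s_def by fastforce
    from sublist_concat_long[OF sub \<open>w \<noteq> []\<close> this] consider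
        a where "a \<in> set u" "sublist w (s (Suc M) a)"
      | a b where "a \<in> set u" "b \<in> set u" "w \<in> cuts n (s (Suc M) a) (s (Suc M) b)"
      using len by auto
    then show "w \<in> C \<union> B1 \<union> (Q \<union> B2 \<union> E)"
    proof cases
      case 1
      then have a: "a \<in> A (Suc M)" using u(1) by auto
      have "w \<in> B1 \<union> (\<Union>c \<in> set (\<tau> M [a]). periodic_words n (s M c))"
        using dec1[OF a _ len] s_Suc[OF a] 1(2) by simp
      then have "w \<in> B1 \<or> (\<exists>c \<in> A M. w \<in> periodic_words n (s M c))"
        using img[OF a] by auto
      then show ?thesis using Q_or by blast
    next
      case 2
      then have "a \<in> A (Suc M)" "b \<in> A (Suc M)" using u(1) by auto
      then show ?thesis using 2(3) unfolding C_def by blast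
    qed
  qed
  moreover have "finite (C \<union> B1 \<union> (Q \<union> B2 \<union> E))"
    using fin B1(1) B2(1) n(1)
    by (auto simp: C_def Q_def E_def q_def finite_cuts finite_periodic_words)
  ultimately have "factor_complexity (S_adic_subshift A \<tau>) n \<le> card (C \<union> B1 \<union> (Q \<union> B2 \<union> E))"
    unfolding factor_complexity_def by (rule card_mono[rotated])
  also have "\<dots> \<le> card C + card B1 + (card Q + card B2 + card E)"
    by (meson add_mono card_Un_le order.trans order.refl)
  also have "\<dots> \<le> K * R * n + R * n + (K * n + R * n + n)"
  proof (intro add_mono)
    have "card C \<le> (\<Sum>(a, b) \<in> A (Suc M) \<times> A (Suc M). card (cuts n (s (Suc M) a) (s (Suc M) b)))"
      unfolding C_def using card_UN_le[OF finite_cartesian_product[OF fin fin]]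
      by (simp add: case_prod_unfold)
    also have "\<dots> \<le> (\<Sum>(a, b) \<in> A (Suc M) \<times> A (Suc M). n)"
      by (intro sum_mono) (auto simp: card_cuts_le)
    also have "\<dots> = card (A (Suc M)) * card (A (Suc M)) * n" by (simp add: card_cartesian_product)
    also have "\<dots> \<le> K * R * n"
    proof (intro mult_mono)
      \<comment> \<open>One of the two factors \<open>card (A (Suc M))\<close> is bounded by
        \<open>R\<close> instead of \<open>K\<close>: each letter has a non-empty image, hence at
        least one block.\<close>
      have "num_blocks (\<tau> M [a]) \<ge> 1" if "a \<in> A (Suc M)" for a
        using dir that by (simp add: directive_sequence_def non_erasing_def num_blocks_def Suc_le_eq)
      then have "card (A (Suc M)) \<le> r_comp (A (Suc M)) (\<tau> M)"
        unfolding r_comp_def card_eq_sum by (rule sum_mono)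
      also have "\<dots> \<le> R" using P by (intro R) simp
      finally show "card (A (Suc M)) \<le> R" .
    qed (use K in auto)
    finally show "card C \<le> K * R * n" .
    show "card B1 \<le> R * n"
      using B1(2) R[of M] P by (meson le_trans mult_le_mono1 less_imp_le le_SucI)
    show "card B2 \<le> R * n"
      using B2(2) R[of P] P by (metis le_trans mult_le_mono1 less_imp_le)
    have "card Q \<le> (\<Sum>c \<in> A M. card (q c))" unfolding Q_def by (rule card_UN_le[OF fin])
    also have "\<dots> \<le> (\<Sum>c \<in> A M. n)"
      using card_periodic_words_le[OF n(1)]
      by (intro sum_mono) (auto simp: q_def card_cuts_le intro: le_trans)
    also have "\<dots> \<le> K * n" using K by simp
    finally show "card Q \<le> K * n" .
    have "card E \<le> (\<Sum>d \<in> A P. card (periodic_words n (s P d)))"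
      unfolding E_def by (rule card_UN_le[OF fin])
    \<comment> \<open>Each letter is charged the length of its image rather than \<open>n\<close>,
      so the minimality of \<open>M\<close> bounds the whole sum by \<open>n\<close>.\<close>
    also have "\<dots> \<le> total_length A \<tau> P"
      unfolding total_length_def s_def by (intro sum_mono card_periodic_words_le n(1))
    finally show "card E \<le> n" using \<open>total_length A \<tau> P \<le> n\<close> by simp
  qed
  also have "\<dots> \<le> (K + 2) * (R + 1) * n" by (simp add: algebra_simps)
  finally show ?thesis .
qed

section \<open>Passage to the supremum and the limsup\<close>

theorem corollary6p13:
  fixes A :: "nat \<Rightarrow> 'a set" and \<tau> :: "nat \<Rightarrow> 'a list \<Rightarrow> 'a list"
  assumes "directive_sequence A \<tau>"
    and "positive_sequence A \<tau>"
  shows "\<forall>\<^sub>F n in sequentially.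
    enat (factor_complexity (S_adic_subshift A \<tau>) n)
      \<le> ((SUP i. enat (card (A i))) + 2)
        * (limsup (\<lambda>i. enat (r_comp (A (Suc i)) (\<tau> i))) + 1) * enat n"
    (is "\<forall>\<^sub>F n in _. _ \<le> (?K + 2) * (?R + 1) * _")
proof (cases "?K = \<infinity> \<or> ?R = \<infinity>")
  case True
  \<comment> \<open>\<open>n > 0\<close> excludes the product of infinity and 0, which is 0 in
    \<open>enat\<close>; the summands 2 and 1 keep the other factors non-zero.\<close>
  have "(?K + 2) * (?R + 1) * enat n = \<infinity>" if "n > 0" for n
    using True that by (auto simp: imult_is_infinity enat_0_iff)
  then show ?thesis
    by (intro eventually_mono[OF eventually_gt_at_top[of 0]]) simp
next
  case False
  then obtain K R where K: "?K = enat K" and R: "?R = enat R" by auto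
  have cardK: "card (A i) \<le> K" for i
    using SUP_upper[of i UNIV "\<lambda>i. enat (card (A i))"] K by simp
  \<comment> \<open>A strict bound on the limsup holds eventually for the terms; as they are
    integers, below \<open>Suc R\<close> means at most \<open>R\<close>.\<close>
  have "?R < enat (Suc R)" by (simp add: R)
  then have "\<forall>\<^sub>F i in sequentially. enat (r_comp (A (Suc i)) (\<tau> i)) < enat (Suc R)"
    by (rule Limsup_lessD)
  then obtain L where L: "\<And>i. i \<ge> L \<Longrightarrow> r_comp (A (Suc i)) (\<tau> i) \<le> R"
    by (auto simp: eventually_sequentially less_Suc_eq_le)
  have "(?K + 2) * (?R + 1) * enat n = enat ((K + 2) * (R + 1) * n)" for n
    by (simp add: K R one_enat_def numeral_eq_enat)
  moreover have "\<forall>\<^sub>F n in sequentially. n > 0 \<and> n \<ge> (\<Sum>N \<le> Suc L. total_length A \<tau> N)"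
    by (intro eventually_conj eventually_gt_at_top eventually_ge_at_top)
  ultimately show ?thesis
    using factor_complexity_le[OF assms cardK L] by (auto elim: eventually_mono)
qed

end
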